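(* Let $g:\mathbb R\to\mathbb R$ be non-decreasing with concave envelope $g^{\mathrm{conc}}\in C^2(\mathbb R)$, let $r:[0,T]\to\mathbb R$ be continuous, and let $w\in C^{1,2}([0,T)\times\mathbb R^d)\cap C([0,T]\times\mathbb R^d)$ be a classical solution of $$-\partial_tw+rw-\tfrac12\Delta w-\bar H(\cdot,\nabla w)=0\ \text{ on }[0,T)\times\mathbb R^d,\qquad w(T,\cdot)=\ell\ \text{ on }\mathbb R^d.$$ Then the function $v(t,x,y):=g^{\mathrm{conc}}\big((w(t,x)-y)e^{\int_t^Tr(s)ds}\big)$ is a classical solution of $$-\partial_tv-\tfrac12\Delta_{xx}v-r\,y\,\partial_yv-F(t,x,Dv,D^2v)=0\ \text{ on }[0,T)\times\mathbb R^d\times\mathbb R,\qquad v(T-,x,y)=g^{\mathrm{conc}}(\ell(x)-y),\ (x,y)\in\mathbb R^d\times\mathbb R.$$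
   Context: Markovian setting: $A,B$ are compact Polish spaces; $\mu:[0,T]\times\mathbb R^d\times A\times B\to\mathbb R^d$ is bounded and measurable, $f:[0,T]\times\mathbb R^d\times A\times B\to\mathbb R$ is measurable, both continuous in $(a,b)\in A\times B$; $\ell:\mathbb R^d\to\mathbb R$ is measurable with polynomial growth. $g^{\mathrm{conc}}$ is the smallest concave majorant of $g$. Hamiltonians: $H(t,x,z,b)=H_t(x,z,b)=\sup_{a\in A}\{z\cdot\mu(t,x,a,b)-f(t,x,a,b)\}$, $\bar H(t,x,z)=\sup_{b\in B}H(t,x,z,b)$; $\partial_zH_t(x,z,b)$ is the subdifferential of the convex function $z\mapsto H(t,x,z,b)$. $Dv=(\partial_xv,\partial_yv)$ and $D^2v$ are the gradient and Hessian in $(x,y)$. For $p=(p_x,p_y)\in\mathbb R^d\times\mathbb R$ and a symmetric matrix $\Theta=\begin{pmatrix}\Theta_{xx}&\Theta_{xy}\\ \Theta_{xy}^\top&\Theta_{yy}\end{pmatrix}$ of size $(d+1)\times(d+1)$, $$F(t,x,p,\Theta):=\sup_{z\in\mathbb R^d,\,b\in B}\ \sup_{q\in\partial_zH_t(x,z,b)}\Big[q\cdot(p_x+p_yz)-H(t,x,z,b)p_y+\tfrac12|z|^2\Theta_{yy}+z\cdot\Theta_{xy}\Big].$$ *)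

theory Defs
  imports "HOL-Analysis.Analysis"
begin

definition grad :: "('e::euclidean_space \<Rightarrow> real) \<Rightarrow> 'e \<Rightarrow> 'e" where
  "grad u x = (THE D. GDERIV u x :> D)"

text \<open>The Hessian as a bilinear form; for basis vectors i and j, the number hess u x i j is the
  matrix entry indexed by (i, j).\<close>

definition hess :: "('e::euclidean_space \<Rightarrow> real) \<Rightarrow> 'e \<Rightarrow> 'e \<Rightarrow> 'e \<Rightarrow> real" where
  "hess u x i j = frechet_derivative (grad u) (at x) j \<bullet> i"

definition laplacian :: "('e::euclidean_space \<Rightarrow> real) \<Rightarrow> 'e \<Rightarrow> real" where
  "laplacian u x = (\<Sum>i\<in>Basis. hess u x i i)"

text \<open>The derivative is taken within [0,T), so it is the right derivative at time 0 and the ordinary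
  derivative at interior times.\<close>

definition time_deriv :: "real \<Rightarrow> (real \<Rightarrow> 'e \<Rightarrow> real) \<Rightarrow> real \<Rightarrow> 'e \<Rightarrow> real" where
  "time_deriv T u t x = vector_derivative (\<lambda>s. u s x) (at t within {0..<T})"

definition C12 :: "real \<Rightarrow> (real \<Rightarrow> 'e::euclidean_space \<Rightarrow> real) \<Rightarrow> bool" where
  "C12 T u \<longleftrightarrow>
     (\<forall>t\<in>{0..<T}. \<forall>x. (\<lambda>s. u s x) differentiable (at t within {0..<T})) \<and>
     (\<forall>t\<in>{0..<T}. \<forall>x. u t differentiable (at x)) \<and>
     (\<forall>t\<in>{0..<T}. \<forall>x. grad (u t) differentiable (at x)) \<and>
     continuous_on ({0..<T} \<times> UNIV) (\<lambda>(t, x). u t x) \<and>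
     continuous_on ({0..<T} \<times> UNIV) (\<lambda>(t, x). time_deriv T u t x) \<and>
     continuous_on ({0..<T} \<times> UNIV) (\<lambda>(t, x). grad (u t) x) \<and>
     (\<forall>i\<in>Basis. \<forall>j\<in>Basis. continuous_on ({0..<T} \<times> UNIV) (\<lambda>(t, x). hess (u t) x i j))"

definition C2 :: "(real \<Rightarrow> real) \<Rightarrow> bool" where
  "C2 h \<longleftrightarrow>
     (\<forall>x. h differentiable (at x)) \<and>
     (\<forall>x. deriv h differentiable (at x)) \<and>
     continuous_on UNIV (deriv (deriv h))"

definition is_concave_envelope :: "(real \<Rightarrow> real) \<Rightarrow> (real \<Rightarrow> real) \<Rightarrow> bool" where
  "is_concave_envelope g G \<longleftrightarrow>
     concave_on UNIV G \<and> (\<forall>x. g x \<le> G x) \<and>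
     (\<forall>h. concave_on UNIV h \<and> (\<forall>x. g x \<le> h x) \<longrightarrow> (\<forall>x. G x \<le> h x))"

definition subdifferential :: "('e::real_inner \<Rightarrow> real) \<Rightarrow> 'e \<Rightarrow> 'e set" where
  "subdifferential \<phi> z = {q. \<forall>z'. \<phi> z + q \<bullet> (z' - z) \<le> \<phi> z'}"

text \<open>The suprema in Ham and Ham_bar are real-valued: they are only used for coefficients that are
  continuous in (a, b) on a nonempty compact space, so the sets involved are nonempty and bounded.\<close>

definition Ham ::
  "(real \<Rightarrow> real ^ 'd \<Rightarrow> 'a \<Rightarrow> 'b \<Rightarrow> real ^ 'd) \<Rightarrow> (real \<Rightarrow> real ^ 'd \<Rightarrow> 'a \<Rightarrow> 'b \<Rightarrow> real) \<Rightarrow>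
    real \<Rightarrow> real ^ 'd \<Rightarrow> real ^ 'd \<Rightarrow> 'b \<Rightarrow> real" where
  "Ham \<mu> f t x z b = (SUP a. z \<bullet> \<mu> t x a b - f t x a b)"

definition Ham_bar ::
  "(real \<Rightarrow> real ^ 'd \<Rightarrow> 'a \<Rightarrow> 'b \<Rightarrow> real ^ 'd) \<Rightarrow> (real \<Rightarrow> real ^ 'd \<Rightarrow> 'a \<Rightarrow> 'b \<Rightarrow> real) \<Rightarrow>
    real \<Rightarrow> real ^ 'd \<Rightarrow> real ^ 'd \<Rightarrow> real" where
  "Ham_bar \<mu> f t x z = (SUP b. Ham \<mu> f t x z b)"

text \<open>A (d+1) by (d+1) matrix is given by its entries \<Theta> i j for standard basis vectors i and j
  of the product of R^d and R, i.e. in the same form as hess. The standard basis consists of the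
  vectors (axis k 1, 0) and of (0, 1).\<close>

definition block_xy :: "((real ^ 'd) \<times> real \<Rightarrow> (real ^ 'd) \<times> real \<Rightarrow> real) \<Rightarrow> real ^ 'd" where
  "block_xy \<Theta> = (\<chi> k. \<Theta> (axis k 1, 0) (0, 1))"

definition block_yy :: "((real ^ 'd) \<times> real \<Rightarrow> (real ^ 'd) \<times> real \<Rightarrow> real) \<Rightarrow> real" where
  "block_yy \<Theta> = \<Theta> (0, 1) (0, 1)"

text \<open>For general arguments the supremum may be infinite, hence the extended real values.\<close>

definition Ham_F ::
  "(real \<Rightarrow> real ^ 'd \<Rightarrow> 'a \<Rightarrow> 'b \<Rightarrow> real ^ 'd) \<Rightarrow> (real \<Rightarrow> real ^ 'd \<Rightarrow> 'a \<Rightarrow> 'b \<Rightarrow> real) \<Rightarrow>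
    real \<Rightarrow> real ^ 'd \<Rightarrow> (real ^ 'd) \<times> real \<Rightarrow>
    ((real ^ 'd) \<times> real \<Rightarrow> (real ^ 'd) \<times> real \<Rightarrow> real) \<Rightarrow> ereal" where
  "Ham_F \<mu> f t x p \<Theta> =
     (SUP z. SUP b. SUP q\<in>subdifferential (\<lambda>z'. Ham \<mu> f t x z' b) z.
        ereal (q \<bullet> (fst p + snd p *\<^sub>R z) - Ham \<mu> f t x z b * snd p
               + 1/2 * (norm z)\<^sup>2 * block_yy \<Theta> + z \<bullet> block_xy \<Theta>))"

end

(* Write G for the envelope, E(t) = exp (int_t^T r) and u = (w - y) E, so v = G(u). By the chain rule
   Dv = G'(u) E (grad w, -1), and the part of the Hessian of v that enters F is G''(u) E^2 times that
   of the rank-one form (grad w, -1) (grad w, -1)^T. Monotonicity of g gives G' >= 0 and concavity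
   gives G'' <= 0; together with the subgradient inequality this makes z = grad w optimal in F, whose
   value is then G'(u) E Hbar(grad w) - G''(u) E^2 |grad w|^2 / 2. Inserting the equation for w gives
   the same expression for the remaining terms of the equation for v. *)

theory Submission
  imports Defs
begin

section \<open>Spatial calculus: gradients and Hessians of compositions and of affine
  expressions\<close>

text \<open>Adapter for continuity conditions stated on time-space pairs, as in \<open>C12\<close>.
  It serves to adjoin the extra variable y and to freeze the space variable.\<close>

lemma continuous_on_compose_pair:
  assumes "continuous_on S (\<lambda>(t, x). k t x)" "continuous_on U a" "continuous_on U b"
    and "\<And>z. z \<in> U \<Longrightarrow> (a z, b z) \<in> S"
  shows "continuous_on U (\<lambda>z. k (a z) (b z))"
proof -
  have "continuous_on U (\<lambda>z. case (a z, b z) of (t, x) \<Rightarrow> k t x)"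
    by (rule continuous_on_compose2[OF assms(1) continuous_on_Pair[OF assms(2,3)]])
      (use assms(4) in auto)
  then show ?thesis by simp
qed

lemma grad_eqI: "GDERIV u x :> D \<Longrightarrow> grad u x = D"
  unfolding grad_def
proof (rule the_equality)
  fix D' assume "GDERIV u x :> D" "GDERIV u x :> D'"
  then have "(\<lambda>h. h \<bullet> D) = (\<lambda>h. h \<bullet> D')"
    unfolding gderiv_def by (rule has_derivative_unique)
  then have "h \<bullet> D' = h \<bullet> D" for h by metis
  then show "D' = D" by (rule vector_eq_ldot[THEN iffD1, rule_format]) 
qed

text \<open>A linear functional on a Euclidean space is the inner product with the vector of its
  values on the basis, so a Frechet derivative is always represented by a gradient.\<close>

lemma GDERIV_grad:
  fixes u :: "'e::euclidean_space \<Rightarrow> real"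
  assumes "u differentiable (at x)"
  shows "GDERIV u x :> grad u x"
proof -
  obtain D where D: "(u has_derivative D) (at x)"
    using assms unfolding differentiable_def by blast
  then have "linear D" by (rule has_derivative_linear)
  have "D h = h \<bullet> (\<Sum>i\<in>Basis. D i *\<^sub>R i)" for h
  proof -
    have "D h = D (\<Sum>i\<in>Basis. (h \<bullet> i) *\<^sub>R i)"
      by (simp only: euclidean_representation)
    also have "\<dots> = (\<Sum>i\<in>Basis. (h \<bullet> i) *\<^sub>R D i)"
      by (simp only: linear_sum[OF \<open>linear D\<close>] linear_cmul[OF \<open>linear D\<close>])
    finally show ?thesis by (simp add: inner_sum_right mult.commute)
  qed
  then have "GDERIV u x :> (\<Sum>i\<in>Basis. D i *\<^sub>R i)"
    using D unfolding gderiv_def by (metis (no_types, lifting) ext)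
  then show ?thesis using grad_eqI by metis
qed

lemma hess_eqI:
  assumes "(grad u has_derivative D) (at x)"
  shows "hess u x i j = D j \<bullet> i"
  unfolding hess_def using frechet_derivative_at[OF assms] by simp

lemma has_derivative_grad:
  assumes "grad u differentiable (at x)"
  shows "(grad u has_derivative frechet_derivative (grad u) (at x)) (at x)"
  using assms frechet_derivative_works by blast

text \<open>Serves Hessian entries on the product space: the basis vector (0, 1) has space component
  0, where the Hessian of a function of x alone must contribute nothing.\<close>

lemma hess_zero_right:
  assumes "grad u differentiable (at x)"
  shows "hess u x i 0 = 0"
  using linear_0[OF has_derivative_linear[OF has_derivative_grad[OF assms]]]
  by (simp add: hess_def)

lemma C2_DERIV:
  assumes "C2 h"
  shows "(h has_real_derivative deriv h s) (at s)"
    and "(deriv h has_real_derivative deriv (deriv h) s) (at s)"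
  using assms unfolding C2_def
  by (auto simp: DERIV_deriv_iff_real_differentiable)

lemma GDERIV_compose_C2:
  fixes u :: "'e::euclidean_space \<Rightarrow> real"
  assumes "C2 h" "u differentiable (at x)"
  shows "GDERIV (\<lambda>x. h (u x)) x :> deriv h (u x) *\<^sub>R grad u x"
  by (rule GDERIV_DERIV_compose[OF GDERIV_grad[OF assms(2)] C2_DERIV(1)[OF assms(1)]])

text \<open>The product rule applied to the gradient formula of the composition. Differentiating it
  requires that formula as an identity of functions, hence differentiability of \<open>u\<close>
  everywhere, but of \<open>grad u\<close> only at \<open>x\<close>.\<close>

lemma has_derivative_grad_compose_C2:
  fixes u :: "'e::euclidean_space \<Rightarrow> real"
  assumes h: "C2 h" and u: "\<And>x. u differentiable (at x)" and du: "grad u differentiable (at x)"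
  shows "(grad (\<lambda>x. h (u x)) has_derivative
    (\<lambda>k. (deriv (deriv h) (u x) * (grad u x \<bullet> k)) *\<^sub>R grad u x
      + deriv h (u x) *\<^sub>R frechet_derivative (grad u) (at x) k)) (at x)"
proof -
  have "((\<lambda>x. deriv h (u x)) has_derivative (\<lambda>k. k \<bullet> (deriv (deriv h) (u x) *\<^sub>R grad u x))) (at x)"
    using GDERIV_DERIV_compose[OF GDERIV_grad[OF u] C2_DERIV(2)[OF h]]
    unfolding gderiv_def .
  from has_derivative_scaleR[OF this has_derivative_grad[OF du]]
  have "((\<lambda>x. deriv h (u x) *\<^sub>R grad u x) has_derivative
    (\<lambda>k. (deriv (deriv h) (u x) * (grad u x \<bullet> k)) *\<^sub>R grad u x
      + deriv h (u x) *\<^sub>R frechet_derivative (grad u) (at x) k)) (at x)"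
    by (simp add: inner_commute algebra_simps)
  moreover have "grad (\<lambda>x. h (u x)) = (\<lambda>x. deriv h (u x) *\<^sub>R grad u x)"
    using grad_eqI[OF GDERIV_compose_C2[OF h u]] by blast
  ultimately show ?thesis by simp
qed

lemma hess_compose_C2:
  fixes u :: "'e::euclidean_space \<Rightarrow> real"
  assumes "C2 h" "\<And>x. u differentiable (at x)" "grad u differentiable (at x)"
  shows "hess (\<lambda>x. h (u x)) x i j =
    deriv (deriv h) (u x) * (grad u x \<bullet> i) * (grad u x \<bullet> j) + deriv h (u x) * hess u x i j"
  by (subst hess_eqI[OF has_derivative_grad_compose_C2[OF assms]])
    (simp add: hess_def inner_add_left)

text \<open>The trace of the Hessian formula: the squared coordinates of the gradient sum to its
  squared norm.\<close>

lemma laplacian_compose_C2: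
  fixes u :: "'e::euclidean_space \<Rightarrow> real"
  assumes "C2 h" "\<And>x. u differentiable (at x)" "grad u differentiable (at x)"
  shows "laplacian (\<lambda>x. h (u x)) x =
    deriv (deriv h) (u x) * (norm (grad u x))\<^sup>2 + deriv h (u x) * laplacian u x"
proof -
  have "(norm (grad u x))\<^sup>2 = (\<Sum>i\<in>Basis. (grad u x \<bullet> i) * (grad u x \<bullet> i))"
    by (metis power2_norm_eq_inner euclidean_inner)
  then show ?thesis
    by (simp add: laplacian_def hess_compose_C2[OF assms] sum.distrib sum_distrib_left mult.assoc)
qed

text \<open>Here y is frozen: the Laplacian in x acts on sections with constant y. The versions with
  suffix \<open>_prod\<close> treat (x, y) jointly.\<close>

lemma GDERIV_affine:
  fixes u :: "'e::euclidean_space \<Rightarrow> real"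
  assumes "u differentiable (at x)"
  shows "GDERIV (\<lambda>x. (u x - y) * c) x :> c *\<^sub>R grad u x"
  using GDERIV_grad[OF assms] unfolding gderiv_def
  by (auto intro!: derivative_eq_intros)

lemma has_derivative_grad_affine:
  fixes u :: "'e::euclidean_space \<Rightarrow> real"
  assumes u: "\<And>x. u differentiable (at x)" and du: "grad u differentiable (at x)"
  shows "(grad (\<lambda>x. (u x - y) * c) has_derivative
    (\<lambda>k. c *\<^sub>R frechet_derivative (grad u) (at x) k)) (at x)"
proof -
  have "grad (\<lambda>x. (u x - y) * c) = (\<lambda>x. c *\<^sub>R grad u x)"
    using grad_eqI[OF GDERIV_affine[OF u]] by blast
  then show ?thesis
    using has_derivative_scaleR_right[OF has_derivative_grad[OF du], of c] by simp
qed

lemma laplacian_affine: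
  fixes u :: "'e::euclidean_space \<Rightarrow> real"
  assumes "\<And>x. u differentiable (at x)" "grad u differentiable (at x)"
  shows "laplacian (\<lambda>x. (u x - y) * c) x = c * laplacian u x"
  by (simp only: laplacian_def hess_eqI[OF has_derivative_grad_affine[OF assms]])
    (simp add: hess_def sum_distrib_left)

lemma GDERIV_affine_prod:
  fixes u :: "'e::euclidean_space \<Rightarrow> real"
  assumes "u differentiable (at (fst p))"
  shows "GDERIV (\<lambda>p. (u (fst p) - snd p) * c) p :> (c *\<^sub>R grad u (fst p), - c)"
proof -
  have "((\<lambda>p. u (fst p)) has_derivative (\<lambda>h. fst h \<bullet> grad u (fst p))) (at p)"
    using has_derivative_compose[OF has_derivative_fst[OF has_derivative_ident]
        GDERIV_grad[OF assms, unfolded gderiv_def]] .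
  then show ?thesis unfolding gderiv_def
    by (auto intro!: derivative_eq_intros simp: inner_prod_def algebra_simps)
qed

lemma has_derivative_grad_affine_prod:
  fixes u :: "'e::euclidean_space \<Rightarrow> real"
  assumes u: "\<And>x. u differentiable (at x)" and du: "grad u differentiable (at (fst p))"
  shows "(grad (\<lambda>p. (u (fst p) - snd p) * c) has_derivative
    (\<lambda>k. (c *\<^sub>R frechet_derivative (grad u) (at (fst p)) (fst k), 0))) (at p)"
proof -
  have eq: "grad (\<lambda>p. (u (fst p) - snd p) * c) = (\<lambda>p. (c *\<^sub>R grad u (fst p), - c))"
    using grad_eqI[OF GDERIV_affine_prod[OF u]] by blast
  have "((\<lambda>p. grad u (fst p)) has_derivative
      (\<lambda>k. frechet_derivative (grad u) (at (fst p)) (fst k))) (at p)"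
    using has_derivative_compose[OF has_derivative_fst[OF has_derivative_ident]
        has_derivative_grad[OF du]] .
  then show ?thesis unfolding eq
    by (auto intro!: derivative_eq_intros)
qed

text \<open>The expression is affine in y with a slope independent of x, so all second derivatives
  involving y vanish and only the space components of \<open>i\<close> and \<open>j\<close>
  matter.\<close>

lemma hess_affine_prod:
  fixes u :: "'e::euclidean_space \<Rightarrow> real"
  assumes "\<And>x. u differentiable (at x)" "grad u differentiable (at (fst p))"
  shows "hess (\<lambda>p. (u (fst p) - snd p) * c) p i j = c * hess u (fst p) (fst i) (fst j)"
  by (simp only: hess_eqI[OF has_derivative_grad_affine_prod[OF assms]])
    (simp add: hess_def inner_prod_def)

section \<open>Time derivatives and the class \<open>C12\<close>\<close>

text \<open>Derivatives within \<open>{0..<T}\<close> are unique because each of its points is a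
  limit point of it, including time 0, where the derivative is one-sided.\<close>

lemma time_deriv_eqI:
  assumes "t \<in> {0..<T}" "((\<lambda>s. u s x) has_vector_derivative D) (at t within {0..<T})"
  shows "time_deriv T u t x = D"
  unfolding time_deriv_def
  by (rule vector_derivative_within[OF _ assms(2)])
    (use assms(1) in \<open>auto simp: trivial_limit_within\<close>)

lemma C12_has_vector_derivative:
  assumes "C12 T u" "t \<in> {0..<T}"
  shows "((\<lambda>s. u s x) has_vector_derivative time_deriv T u t x) (at t within {0..<T})"
  using assms vector_derivative_works unfolding C12_def time_deriv_def by blast

lemma C12_differentiable:
  assumes "C12 T u" "t \<in> {0..<T}"
  shows "u t differentiable (at x)" "grad (u t) differentiable (at x)"
  using assms unfolding C12_def by blast+

lemma time_deriv_cong: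
  assumes "\<And>t. t \<in> {0..<T} \<Longrightarrow> u t = u' t" "t \<in> {0..<T}"
  shows "time_deriv T u t x = time_deriv T u' t x"
  unfolding time_deriv_def
  by (rule vector_derivative_cong_eq) (use assms in auto)

text \<open>In the theorem \<open>v\<close> is prescribed by its formula only at times in [0,T];
  this transfers regularity from the function given by that formula at all times.\<close>

lemma C12_cong:
  assumes eq: "\<And>t. t \<in> {0..<T} \<Longrightarrow> u t = u' t" and C: "C12 T u'"
  shows "C12 T u"
proof -
  have "(\<lambda>s. u s x) differentiable (at t within {0..<T})" if "t \<in> {0..<T}" for t x
  proof -
    have "(\<lambda>s. u' s x) differentiable (at t within {0..<T})"
      using C that unfolding C12_def by blast
    then show ?thesis unfolding differentiable_def
      using that eq by (metis (no_types, lifting) has_derivative_transform)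
  qed
  \<comment> \<open>The operator \<open>k\<close> stands for the identity, the time derivative, the
    gradient and the Hessian entries, so one argument handles all four continuity
    conditions.\<close>
  moreover have "continuous_on ({0..<T} \<times> UNIV) (\<lambda>(t, x). k u t x)"
    if "continuous_on ({0..<T} \<times> UNIV) (\<lambda>(t, x). k u' t x)"
      "\<And>t x. t \<in> {0..<T} \<Longrightarrow> k u t x = k u' t x"
    for k :: "(real \<Rightarrow> 'a \<Rightarrow> real) \<Rightarrow> real \<Rightarrow> 'a \<Rightarrow> 'c::topological_space"
    by (rule continuous_on_eq[OF that(1)]) (auto simp: that(2))
  note this[of "\<lambda>u. u"] this[of "time_deriv T"] this[of "\<lambda>u t. grad (u t)"]
    this[of "\<lambda>u t x. hess (u t) x i j" for i j]
  ultimately show ?thesis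
    using C time_deriv_cong[of T u u', OF eq] unfolding C12_def by (simp add: eq)
qed

lemma has_vector_derivative_compose_C2:
  assumes "C2 h" "C12 T u" "t \<in> {0..<T}"
  shows "((\<lambda>s. h (u s x)) has_vector_derivative deriv h (u t x) * time_deriv T u t x)
    (at t within {0..<T})"
proof -
  have "((\<lambda>s. u s x) has_real_derivative time_deriv T u t x) (at t within {0..<T})"
    using C12_has_vector_derivative[OF assms(2,3)]
    by (simp add: has_real_derivative_iff_has_vector_derivative)
  from DERIV_chain2[OF C2_DERIV(1)[OF assms(1)] this] show ?thesis
    by (simp add: has_real_derivative_iff_has_vector_derivative)
qed

lemma time_deriv_compose_C2:
  assumes "C2 h" "C12 T u" "t \<in> {0..<T}"
  shows "time_deriv T (\<lambda>t x. h (u t x)) t x = deriv h (u t x) * time_deriv T u t x"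
  by (rule time_deriv_eqI[where u = "\<lambda>t x. h (u t x)", OF assms(3)
        has_vector_derivative_compose_C2[OF assms]])

text \<open>Each derivative of the composition agrees on [0,T) with its chain-rule expression, which
  is visibly continuous.\<close>

lemma C12_compose_C2:
  fixes u :: "real \<Rightarrow> 'e::euclidean_space \<Rightarrow> real"
  assumes h: "C2 h" and u: "C12 T u"
  shows "C12 T (\<lambda>t x. h (u t x))"
proof -
  note d = C12_differentiable[OF u]
  have cu: "continuous_on ({0..<T} \<times> UNIV) (\<lambda>z. u (fst z) (snd z))"
    and ct: "continuous_on ({0..<T} \<times> UNIV) (\<lambda>z. time_deriv T u (fst z) (snd z))"
    and cg: "continuous_on ({0..<T} \<times> UNIV) (\<lambda>z. grad (u (fst z)) (snd z))"
    and ch: "\<And>i j. i \<in> Basis \<Longrightarrow> j \<in> Basis \<Longrightarrow>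
      continuous_on ({0..<T} \<times> UNIV) (\<lambda>z. hess (u (fst z)) (snd z) i j)"
    using u unfolding C12_def split_beta by blast+
  have "continuous_on UNIV h" "continuous_on UNIV (deriv h)" "continuous_on UNIV (deriv (deriv h))"
    using C2_DERIV[OF h] h unfolding C2_def
    by (auto intro!: DERIV_continuous_on)
  note ch' = this[THEN continuous_on_compose2[OF _ cu]]
  have "(\<lambda>s. h (u s x)) differentiable (at t within {0..<T})" if "t \<in> {0..<T}" for t x
    using has_vector_derivative_compose_C2[OF h u that] by (rule differentiableI_vector)
  moreover have "(\<lambda>x. h (u t x)) differentiable (at x)" if "t \<in> {0..<T}" for t x
    using GDERIV_compose_C2[OF h d(1)[OF that]] unfolding gderiv_def by (rule differentiableI)
  moreover have "grad (\<lambda>x. h (u t x)) differentiable (at x)" if "t \<in> {0..<T}" for t x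
    using has_derivative_grad_compose_C2[OF h d[OF that]] by (rule differentiableI)
  moreover have "continuous_on ({0..<T} \<times> UNIV) (\<lambda>z. h (u (fst z) (snd z)))"
    using ch'(1) by simp
  moreover have "continuous_on ({0..<T} \<times> UNIV) (\<lambda>z. time_deriv T (\<lambda>t x. h (u t x)) (fst z) (snd z))"
  proof (rule continuous_on_eq)
    show "continuous_on ({0..<T} \<times> UNIV)
        (\<lambda>z. deriv h (u (fst z) (snd z)) * time_deriv T u (fst z) (snd z))"
      using ch'(2) ct by (auto intro!: continuous_intros)
  qed (auto simp: time_deriv_compose_C2[OF h u])
  moreover have "continuous_on ({0..<T} \<times> UNIV) (\<lambda>z. grad (\<lambda>x. h (u (fst z) x)) (snd z))"
  proof (rule continuous_on_eq)
    show "continuous_on ({0..<T} \<times> UNIV)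
        (\<lambda>z. deriv h (u (fst z) (snd z)) *\<^sub>R grad (u (fst z)) (snd z))"
      using ch'(2) cg by (auto intro!: continuous_intros)
  qed (auto intro!: grad_eqI[symmetric] GDERIV_compose_C2[OF h] d)
  moreover have "continuous_on ({0..<T} \<times> UNIV) (\<lambda>z. hess (\<lambda>x. h (u (fst z) x)) (snd z) i j)"
    if "i \<in> Basis" "j \<in> Basis" for i j
  proof (rule continuous_on_eq)
    show "continuous_on ({0..<T} \<times> UNIV)
        (\<lambda>z. deriv (deriv h) (u (fst z) (snd z)) * (grad (u (fst z)) (snd z) \<bullet> i)
           * (grad (u (fst z)) (snd z) \<bullet> j) + deriv h (u (fst z) (snd z)) * hess (u (fst z)) (snd z) i j)"
      using ch'(2,3) cg ch[OF that] by (auto intro!: continuous_intros)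
  qed (auto intro!: hess_compose_C2[OF h, symmetric] d)
  ultimately show ?thesis
    unfolding C12_def split_beta by blast
qed

lemma has_vector_derivative_affine_prod:
  fixes u :: "real \<Rightarrow> 'e::euclidean_space \<Rightarrow> real"
  assumes u: "C12 T u" and c: "(c has_real_derivative c') (at t within {0..<T})" and t: "t \<in> {0..<T}"
  shows "((\<lambda>s. (u s (fst p) - snd p) * c s) has_vector_derivative
    time_deriv T u t (fst p) * c t + (u t (fst p) - snd p) * c') (at t within {0..<T})"
proof -
  have "((\<lambda>s. u s (fst p)) has_real_derivative time_deriv T u t (fst p)) (at t within {0..<T})"
    using C12_has_vector_derivative[OF u t]
    by (simp add: has_real_derivative_iff_has_vector_derivative)
  with c show ?thesis
    unfolding has_real_derivative_iff_has_vector_derivative[symmetric]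
    by (auto intro!: derivative_eq_intros)
qed

lemma time_deriv_affine_prod:
  fixes u :: "real \<Rightarrow> 'e::euclidean_space \<Rightarrow> real"
  assumes "C12 T u" "(c has_real_derivative c') (at t within {0..<T})" "t \<in> {0..<T}"
  shows "time_deriv T (\<lambda>t p. (u t (fst p) - snd p) * c t) t p
    = time_deriv T u t (fst p) * c t + (u t (fst p) - snd p) * c'"
  by (rule time_deriv_eqI[where u = "\<lambda>t p. (u t (fst p) - snd p) * c t", OF assms(3)
        has_vector_derivative_affine_prod[OF assms]])

text \<open>Applied with \<open>c\<close> the factor \<open>exp (integral {t..T} r)\<close>; the
  continuity of \<open>c'\<close> is what makes the time derivative continuous.\<close>

lemma C12_affine_prod:
  fixes u :: "real \<Rightarrow> 'e::euclidean_space \<Rightarrow> real"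
  assumes u: "C12 T u"
    and c: "\<And>t. t \<in> {0..<T} \<Longrightarrow> (c has_real_derivative c' t) (at t within {0..<T})"
    and c': "continuous_on {0..<T} c'"
  shows "C12 T (\<lambda>t p. (u t (fst p) - snd p) * c t)"
proof -
  let ?S = "{0..<T} \<times> (UNIV :: ('e \<times> real) set)"
  note d = C12_differentiable[OF u]
  have *: "continuous_on ?S (\<lambda>z. k (fst z) (fst (snd z)))"
    if "continuous_on ({0..<T} \<times> UNIV) (\<lambda>(t, x). k t x)"
    for k :: "real \<Rightarrow> 'e \<Rightarrow> 'c::topological_space"
    by (rule continuous_on_compose_pair[OF that]) (auto intro!: continuous_intros)
  have cu: "continuous_on ?S (\<lambda>z. u (fst z) (fst (snd z)))"
    and ct: "continuous_on ?S (\<lambda>z. time_deriv T u (fst z) (fst (snd z)))"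
    and cg: "continuous_on ?S (\<lambda>z. grad (u (fst z)) (fst (snd z)))"
    and ch: "\<And>i j. i \<in> Basis \<Longrightarrow> j \<in> Basis \<Longrightarrow>
      continuous_on ?S (\<lambda>z. hess (u (fst z)) (fst (snd z)) i j)"
    using u unfolding C12_def by (auto intro!: *)
  have "continuous_on {0..<T} c"
    using c by (rule DERIV_continuous_on)
  note cc = this[THEN continuous_on_compose2, OF continuous_on_fst[OF continuous_on_id], of ?S]
    c'[THEN continuous_on_compose2, OF continuous_on_fst[OF continuous_on_id], of ?S]
  have "(\<lambda>s. (u s (fst p) - snd p) * c s) differentiable (at t within {0..<T})"
    if "t \<in> {0..<T}" for t p
    using has_vector_derivative_affine_prod[OF u c[OF that] that] by (rule differentiableI_vector)
  moreover have "(\<lambda>p. (u t (fst p) - snd p) * c t) differentiable (at p)" if "t \<in> {0..<T}" for t p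
    using GDERIV_affine_prod[OF d(1)[OF that]] unfolding gderiv_def by (rule differentiableI)
  moreover have "grad (\<lambda>p. (u t (fst p) - snd p) * c t) differentiable (at p)"
    if "t \<in> {0..<T}" for t p
    using has_derivative_grad_affine_prod[OF d[OF that]] by (rule differentiableI)
  moreover have "continuous_on ?S (\<lambda>z. (u (fst z) (fst (snd z)) - snd (snd z)) * c (fst z))"
    using cu cc by (auto intro!: continuous_intros)
  moreover have "continuous_on ?S
      (\<lambda>z. time_deriv T (\<lambda>t p. (u t (fst p) - snd p) * c t) (fst z) (snd z))"
  proof (rule continuous_on_eq)
    show "continuous_on ?S (\<lambda>z. time_deriv T u (fst z) (fst (snd z)) * c (fst z)
        + (u (fst z) (fst (snd z)) - snd (snd z)) * c' (fst z))"
      using cu ct cc by (auto intro!: continuous_intros)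
  qed (auto simp: time_deriv_affine_prod[OF u c])
  moreover have "continuous_on ?S (\<lambda>z. grad (\<lambda>p. (u (fst z) (fst p) - snd p) * c (fst z)) (snd z))"
  proof (rule continuous_on_eq)
    show "continuous_on ?S (\<lambda>z. (c (fst z) *\<^sub>R grad (u (fst z)) (fst (snd z)), - c (fst z)))"
      using cg cc by (auto intro!: continuous_intros)
  qed (auto intro!: grad_eqI[symmetric] GDERIV_affine_prod[of _ "(x, y)" for x y, simplified] d)
  moreover have "continuous_on ?S
      (\<lambda>z. hess (\<lambda>p. (u (fst z) (fst p) - snd p) * c (fst z)) (snd z) i j)"
    if "i \<in> Basis" "j \<in> Basis" for i j
  proof (rule continuous_on_eq)
    have "continuous_on ?S (\<lambda>z. hess (u (fst z)) (fst (snd z)) (fst i) (fst j))"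
    \<comment> \<open>A basis vector of the product has as space component either 0 or a basis
      vector; in the first case the entry is constantly 0.\<close>
    proof (cases "fst i = 0 \<or> fst j = 0")
      case True
      then have "hess (u t) x (fst i) (fst j) = 0" if "t \<in> {0..<T}" for t x
        using hess_zero_right[OF d(2)[OF that]] by (auto simp: hess_def[of _ _ 0])
      then show ?thesis
        by (intro continuous_on_eq[OF continuous_on_const[of _ 0]]) auto
    next
      case False
      then have "fst i \<in> Basis" "fst j \<in> Basis"
        using that by (auto simp: Basis_prod_def)
      then show ?thesis by (rule ch)
    qed
    then show "continuous_on ?S (\<lambda>z. c (fst z) * hess (u (fst z)) (fst (snd z)) (fst i) (fst j))"
      using cc by (auto intro!: continuous_intros)
  qed (auto simp: hess_affine_prod[OF d])
  ultimately show ?thesis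
    unfolding C12_def split_beta by blast
qed

section \<open>Signs of the first two derivatives of the concave envelope\<close>

lemma concave_below_tangent:
  fixes G :: "real \<Rightarrow> real"
  assumes "concave_on UNIV G" "(G has_real_derivative D) (at s)"
  shows "G s' \<le> G s + D * (s' - s)"
proof -
  have "((\<lambda>s. - G s) has_real_derivative - D) (at s within UNIV)"
    using DERIV_minus[OF assms(2)] by simp
  with assms(1) have "- D * (s' - s) \<le> - G s' - - G s"
    unfolding concave_on_def by (intro convex_on_imp_above_tangent[where A = UNIV]) auto
  then show ?thesis by simp
qed

text \<open>With a negative slope, the tangent at \<open>s\<close> would force \<open>G\<close>
  below the level \<open>g s\<close> far to the right, whereas there \<open>G\<close> dominates
  \<open>g\<close>, which is at least \<open>g s\<close>.\<close>

lemma concave_majorant_deriv_nonneg: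
  fixes G :: "real \<Rightarrow> real"
  assumes G: "concave_on UNIV G" "(G has_real_derivative D) (at s)"
    and g: "mono g" "\<And>s. g s \<le> G s"
  shows "0 \<le> D"
proof (rule ccontr)
  assume "\<not> 0 \<le> D"
  then have D: "D < 0" by simp
  \<comment> \<open>The second argument is the point where the tangent takes the value
    \<open>g s - 1\<close>; the \<open>max\<close> makes \<open>s \<le> s'\<close>
    immediate.\<close>
  define s' where "s' = max s (s + (g s - G s - 1) / D)"
  have "g s \<le> g s'"
    using g(1) by (auto simp: mono_def s'_def)
  also have "\<dots> \<le> G s + D * (s' - s)"
    using g(2) concave_below_tangent[OF G] order_trans by blast
  also have "D * (s' - s) \<le> D * ((g s - G s - 1) / D)"
    using D by (intro mult_left_mono_neg) (auto simp: s'_def)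
  also have "\<dots> = g s - G s - 1"
    using D by simp
  finally show False by simp
qed

text \<open>A positive second derivative would make the slope larger slightly to the right. Adding
  the tangent inequalities at both points, each evaluated at the other, excludes this.\<close>

lemma concave_second_deriv_nonpos:
  fixes G :: "real \<Rightarrow> real"
  assumes G: "concave_on UNIV G" "C2 G"
  shows "deriv (deriv G) s \<le> 0"
proof (rule ccontr)
  assume "\<not> deriv (deriv G) s \<le> 0"
  then obtain d where d: "0 < d" "\<And>h. 0 < h \<Longrightarrow> h < d \<Longrightarrow> deriv G s < deriv G (s + h)"
    using DERIV_pos_inc_right[OF C2_DERIV(2)[OF G(2)], of s] by (metis not_le)
  define h where "h = d / 2"
  have h: "0 < h" "deriv G s < deriv G (s + h)"
    using d by (auto simp: h_def)
  have "G (s + h) \<le> G s + deriv G s * h" "G s \<le> G (s + h) - deriv G (s + h) * h"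
    using concave_below_tangent[OF G(1) C2_DERIV(1)[OF G(2)], of "s + h" s]
      concave_below_tangent[OF G(1) C2_DERIV(1)[OF G(2)], of s "s + h"] by auto
  then have "deriv G (s + h) * h \<le> deriv G s * h" by linarith
  with h show False by simp
qed

section \<open>The Hamiltonians and the explicit value of F\<close>

lemma Ham_attained:
  fixes \<mu> :: "real \<Rightarrow> real ^ 'd \<Rightarrow> 'a::topological_space \<Rightarrow> 'b::topological_space \<Rightarrow> real ^ 'd"
  assumes "compact (UNIV :: 'a set)"
    and "continuous_on UNIV (\<lambda>(a, b). \<mu> t x a b)" "continuous_on UNIV (\<lambda>(a, b). f t x a b)"
  obtains a where "Ham \<mu> f t x z b = z \<bullet> \<mu> t x a b - f t x a b"
    and "\<And>a'. z \<bullet> \<mu> t x a' b - f t x a' b \<le> z \<bullet> \<mu> t x a b - f t x a b"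
proof -
  have pair: "continuous_on UNIV (\<lambda>a. (a, b))"
    by (intro continuous_intros)
  have "continuous_on UNIV (\<lambda>a. z \<bullet> \<mu> t x a b - f t x a b)"
    using assms(2,3)[THEN continuous_on_compose2, OF pair] by (auto intro!: continuous_intros)
  from continuous_attains_sup[OF assms(1) _ this]
  obtain a where a: "\<And>a'. z \<bullet> \<mu> t x a' b - f t x a' b \<le> z \<bullet> \<mu> t x a b - f t x a b" by auto
  then have "Ham \<mu> f t x z b = z \<bullet> \<mu> t x a b - f t x a b"
    unfolding Ham_def by (intro cSup_eq_maximum) auto
  with a that show thesis by blast
qed

text \<open>If \<open>a\<close> is a maximiser at \<open>z\<close>, the affine function of slope
  \<open>\<mu> t x a b\<close> belonging to \<open>a\<close> lies below H and touches it at
  \<open>z\<close>. Nonemptiness matters since a supremum over the empty set would be minus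
  infinity.\<close>

lemma subdifferential_Ham_nonempty:
  fixes \<mu> :: "real \<Rightarrow> real ^ 'd \<Rightarrow> 'a::topological_space \<Rightarrow> 'b::topological_space \<Rightarrow> real ^ 'd"
  assumes "compact (UNIV :: 'a set)"
    and "continuous_on UNIV (\<lambda>(a, b). \<mu> t x a b)" "continuous_on UNIV (\<lambda>(a, b). f t x a b)"
  shows "subdifferential (\<lambda>z'. Ham \<mu> f t x z' b) z \<noteq> {}"
proof -
  obtain a where a: "Ham \<mu> f t x z b = z \<bullet> \<mu> t x a b - f t x a b"
    using Ham_attained[of \<mu> t x f _ b, OF assms] by metis
  have "z' \<bullet> \<mu> t x a b - f t x a b \<le> Ham \<mu> f t x z' b" for z'
    using Ham_attained[of \<mu> t x f _ b, OF assms] by metis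
  with a have "\<mu> t x a b \<in> subdifferential (\<lambda>z'. Ham \<mu> f t x z' b) z"
    unfolding subdifferential_def by (simp add: inner_diff_right inner_commute)
  then show ?thesis by blast
qed

text \<open>The maximum over the compact product of both control spaces bounds H uniformly in b, so
  that the real-valued supremum \<open>Ham_bar\<close> really is an upper bound.\<close>

lemma bdd_above_Ham:
  fixes \<mu> :: "real \<Rightarrow> real ^ 'd \<Rightarrow> 'a::topological_space \<Rightarrow> 'b::topological_space \<Rightarrow> real ^ 'd"
  assumes "compact (UNIV :: 'a set)" "compact (UNIV :: 'b set)"
    and "continuous_on UNIV (\<lambda>(a, b). \<mu> t x a b)" "continuous_on UNIV (\<lambda>(a, b). f t x a b)"
  shows "bdd_above (range (Ham \<mu> f t x z))"
proof -
  have "continuous_on UNIV (\<lambda>p. z \<bullet> \<mu> t x (fst p) (snd p) - f t x (fst p) (snd p))"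
    using assms(3,4) unfolding split_beta by (auto intro!: continuous_intros)
  moreover have "compact (UNIV :: ('a \<times> 'b) set)"
    using compact_Times[OF assms(1,2)] by simp
  ultimately obtain p where p: "\<And>a b. z \<bullet> \<mu> t x a b - f t x a b
      \<le> z \<bullet> \<mu> t x (fst p) (snd p) - f t x (fst p) (snd p)"
    using continuous_attains_sup[of UNIV
        "\<lambda>p. z \<bullet> \<mu> t x (fst p) (snd p) - f t x (fst p) (snd p)"] by force
  then have "Ham \<mu> f t x z b \<le> z \<bullet> \<mu> t x (fst p) (snd p) - f t x (fst p) (snd p)" for b
    unfolding Ham_def by (intro cSUP_least) auto
  then show ?thesis by (auto intro!: bdd_aboveI)
qed

text \<open>The expression inside the suprema equals
  \<open>c (H(z, b) + q \<bullet> (m - z)) + k/2 |z - m|\<^sup>2 - k/2 |m|\<^sup>2\<close>. As \<open>q\<close> is a subgradient at \<open>z\<close>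
  and \<open>k \<le> 0 \<le> c\<close>, it is at most its value at \<open>z = m\<close>.\<close>

lemma Ham_F_eq:
  fixes \<mu> :: "real \<Rightarrow> real ^ 'd \<Rightarrow> 'a::topological_space \<Rightarrow> 'b::topological_space \<Rightarrow> real ^ 'd"
  assumes A: "compact (UNIV :: 'a set)" and B: "compact (UNIV :: 'b set)"
    and cont: "continuous_on UNIV (\<lambda>(a, b). \<mu> t x a b)" "continuous_on UNIV (\<lambda>(a, b). f t x a b)"
    and c: "0 \<le> c" and k: "k \<le> 0"
    and \<Theta>: "block_yy \<Theta> = k" "block_xy \<Theta> = - k *\<^sub>R m"
  shows "Ham_F \<mu> f t x (c *\<^sub>R m, - c) \<Theta>
    = ereal (c * Ham_bar \<mu> f t x m - 1/2 * k * (norm m)\<^sup>2)"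
proof -
  let ?H = "Ham \<mu> f t x"
  let ?sub = "\<lambda>z b. subdifferential (\<lambda>z'. ?H z' b) z"
  define \<phi> where "\<phi> z b q = c * (?H z b + q \<bullet> (m - z)) + 1/2 * k * (norm (z - m))\<^sup>2 - 1/2 * k * (norm m)\<^sup>2"
    for z b q
  have F: "Ham_F \<mu> f t x (c *\<^sub>R m, - c) \<Theta> = (SUP z. SUP b. SUP q\<in>?sub z b. ereal (\<phi> z b q))"
    unfolding Ham_F_def \<Theta> \<phi>_def power2_norm_eq_inner
    by (simp add: inner_diff_left inner_diff_right inner_commute algebra_simps)
  have upper: "\<phi> z b q \<le> c * Ham_bar \<mu> f t x m - 1/2 * k * (norm m)\<^sup>2" if "q \<in> ?sub z b" for z b q
  proof -
    have "?H z b + q \<bullet> (m - z) \<le> ?H m b"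
      using that by (simp add: subdifferential_def)
    also have "\<dots> \<le> Ham_bar \<mu> f t x m"
      unfolding Ham_bar_def by (rule cSUP_upper[OF UNIV_I bdd_above_Ham[of \<mu> t x f, OF A B cont]])
    finally have "c * (?H z b + q \<bullet> (m - z)) \<le> c * Ham_bar \<mu> f t x m"
      using c by (rule mult_left_mono)
    moreover have "1/2 * k * (norm (z - m))\<^sup>2 \<le> 0"
      using k by (simp add: mult_nonpos_nonneg)
    ultimately show ?thesis unfolding \<phi>_def by linarith
  qed
  \<comment> \<open>At \<open>z = m\<close> the value of \<open>\<phi>\<close> does not depend on
    the subgradient, so any one will do.\<close>
  have lower: "ereal (c * ?H m b - 1/2 * k * (norm m)\<^sup>2) \<le> Ham_F \<mu> f t x (c *\<^sub>R m, - c) \<Theta>" for b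
  proof -
    obtain q where "q \<in> ?sub m b"
      using subdifferential_Ham_nonempty[of \<mu> t x f b m, OF A cont] by blast
    then have "ereal (\<phi> m b q) \<le> Ham_F \<mu> f t x (c *\<^sub>R m, - c) \<Theta>"
      unfolding F by (intro SUP_upper2[of m] SUP_upper2[of b] SUP_upper2[of q]) auto
    then show ?thesis by (simp add: \<phi>_def)
  qed
  have le: "Ham_F \<mu> f t x (c *\<^sub>R m, - c) \<Theta> \<le> ereal (c * Ham_bar \<mu> f t x m - 1/2 * k * (norm m)\<^sup>2)"
    unfolding F by (intro SUP_least ereal_less_eq(3)[THEN iffD2] upper)
  \<comment> \<open>Real bounds on both sides make F finite; the remaining inequality is then proved
    in the reals.\<close>
  then obtain F' where F': "Ham_F \<mu> f t x (c *\<^sub>R m, - c) \<Theta> = ereal F'"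
    using lower[of undefined] by (cases "Ham_F \<mu> f t x (c *\<^sub>R m, - c) \<Theta>") auto
  have "c * Ham_bar \<mu> f t x m - 1/2 * k * (norm m)\<^sup>2 \<le> F'"
  \<comment> \<open>Passing to the supremum over b divides by \<open>c\<close>. If
    \<open>c = 0\<close>, the term with H disappears and the bound from a single b suffices.\<close>
  proof (cases "c = 0")
    case True
    then show ?thesis using lower[of undefined] F' by simp
  next
    case False
    with c have "0 < c" by simp
    have "?H m b \<le> (F' + 1/2 * k * (norm m)\<^sup>2) / c" for b
      using lower[of b] F' \<open>0 < c\<close> by (simp add: field_simps)
    then have "Ham_bar \<mu> f t x m \<le> (F' + 1/2 * k * (norm m)\<^sup>2) / c"
      unfolding Ham_bar_def by (intro cSUP_least) auto
    with \<open>0 < c\<close> show ?thesis by (simp add: field_simps)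
  qed
  with le F' show ?thesis by simp
qed

section \<open>Regularity, terminal limit and equation for the transformed function\<close>

theorem propositionA1:
  fixes T :: real
    and \<mu> :: "real \<Rightarrow> real ^ 'd \<Rightarrow> 'a::polish_space \<Rightarrow> 'b::polish_space \<Rightarrow> real ^ 'd"
    and f :: "real \<Rightarrow> real ^ 'd \<Rightarrow> 'a \<Rightarrow> 'b \<Rightarrow> real"
    and ell :: "real ^ 'd \<Rightarrow> real"
    and g gconc :: "real \<Rightarrow> real"
    and r :: "real \<Rightarrow> real"
    and w :: "real \<Rightarrow> real ^ 'd \<Rightarrow> real"
    and v :: "real \<Rightarrow> (real ^ 'd) \<times> real \<Rightarrow> real"
  assumes T_pos: "0 < T"
    and compact_A: "compact (UNIV :: 'a set)"
    and compact_B: "compact (UNIV :: 'b set)"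
    and mu_meas: "(\<lambda>(t, x, a, b). \<mu> t x a b) \<in> borel_measurable (restrict_space borel ({0..T} \<times> UNIV))"
    and mu_bdd: "\<exists>C. \<forall>t\<in>{0..T}. \<forall>x a b. norm (\<mu> t x a b) \<le> C"
    and mu_cont: "\<And>t x. t \<in> {0..T} \<Longrightarrow> continuous_on UNIV (\<lambda>(a, b). \<mu> t x a b)"
    and f_meas: "(\<lambda>(t, x, a, b). f t x a b) \<in> borel_measurable (restrict_space borel ({0..T} \<times> UNIV))"
    and f_cont: "\<And>t x. t \<in> {0..T} \<Longrightarrow> continuous_on UNIV (\<lambda>(a, b). f t x a b)"
    and l_meas: "ell \<in> borel_measurable borel"
    and l_growth: "\<exists>C m. \<forall>x. \<bar>ell x\<bar> \<le> C * (1 + norm x ^ m)"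
    and g_mono: "mono g"
    and gconc_env: "is_concave_envelope g gconc"
    and gconc_C2: "C2 gconc"
    and r_cont: "continuous_on {0..T} r"
    and w_C12: "C12 T w"
    and w_cont: "continuous_on ({0..T} \<times> UNIV) (\<lambda>(t, x). w t x)"
    and w_pde: "\<And>t x. t \<in> {0..<T} \<Longrightarrow>
      - time_deriv T w t x + r t * w t x - 1/2 * laplacian (w t) x - Ham_bar \<mu> f t x (grad (w t) x) = 0"
    and w_terminal: "\<And>x. w T x = ell x"
    and v_def: "\<And>t x y. t \<in> {0..T} \<Longrightarrow> v t (x, y) = gconc ((w t x - y) * exp (integral {t..T} r))"
  shows "C12 T v \<and>
    continuous_on ({0..T} \<times> UNIV) (\<lambda>(t, p). v t p) \<and>
    (\<forall>t\<in>{0..<T}. \<forall>x y.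
      ereal (- time_deriv T v t (x, y) - 1/2 * laplacian (\<lambda>x'. v t (x', y)) x
             - r t * y * deriv (\<lambda>y'. v t (x, y')) y)
        - Ham_F \<mu> f t x (grad (v t) (x, y)) (hess (v t) (x, y)) = 0) \<and>
    (\<forall>x y. ((\<lambda>t. v t (x, y)) \<longlongrightarrow> gconc (ell x - y)) (at_left T))"
proof -
  define E where "E t = exp (integral {t..T} r)" for t
  define u where "u t p = (w t (fst p) - snd p) * E t" for t p
  have v_eq: "v t = (\<lambda>p. gconc (u t p))" if "t \<in> {0..T}" for t
    using v_def[OF that] by (auto simp: u_def E_def)
  have conc: "concave_on UNIV gconc" and major: "\<And>s. g s \<le> gconc s"
    using gconc_env unfolding is_concave_envelope_def by blast+
  note G = C2_DERIV[OF gconc_C2]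
  have G'_nonneg: "0 \<le> deriv gconc s" for s
    by (rule concave_majorant_deriv_nonneg[OF conc G(1) g_mono major])
  have G''_nonpos: "deriv (deriv gconc) s \<le> 0" for s
    by (rule concave_second_deriv_nonpos[OF conc gconc_C2])
  have E_pos: "0 < E t" for t by (simp add: E_def)
  \<comment> \<open>The minus sign arises because t is the lower limit of the integral.\<close>
  have E_deriv: "(E has_real_derivative - r t * E t) (at t within {0..T})" if "t \<in> {0..T}" for t
    unfolding E_def using integral_has_real_derivative'[OF r_cont that]
    by (auto intro!: derivative_eq_intros)
  have E_deriv': "(E has_real_derivative - r t * E t) (at t within {0..<T})" if "t \<in> {0..<T}" for t
    by (rule DERIV_subset[OF E_deriv]) (use that in auto)
  have E_cont: "continuous_on {0..T} E"
    using E_deriv by (rule DERIV_continuous_on)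
  have "continuous_on {0..<T} (\<lambda>t. - r t * E t)"
    using r_cont E_cont by (auto intro!: continuous_intros elim: continuous_on_subset)
  from C12_affine_prod[OF w_C12 E_deriv' this] have u_C12: "C12 T u"
    unfolding u_def .
  note dw = C12_differentiable[OF w_C12] and du = C12_differentiable[OF u_C12]
  have v_C12: "C12 T v"
    by (rule C12_cong[OF _ C12_compose_C2[OF gconc_C2 u_C12]]) (simp add: v_eq)
  have v_cont: "continuous_on ({0..T} \<times> UNIV) (\<lambda>(t, p). v t p)"
  proof -
    let ?S = "{0..T} \<times> (UNIV :: ((real ^ 'd) \<times> real) set)"
    have "continuous_on ?S (\<lambda>z. w (fst z) (fst (snd z)))"
      by (rule continuous_on_compose_pair[OF w_cont]) (auto intro!: continuous_intros)
    moreover have "continuous_on ?S (\<lambda>z. E (fst z))"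
      by (rule continuous_on_compose2[OF E_cont]) (auto intro!: continuous_intros)
    ultimately have "continuous_on ?S (\<lambda>z. u (fst z) (snd z))"
      unfolding u_def by (intro continuous_intros)
    moreover have "continuous_on UNIV gconc"
      using G(1) by (auto intro!: DERIV_continuous_on)
    ultimately have "continuous_on ?S (\<lambda>z. gconc (u (fst z) (snd z)))"
      using continuous_on_compose2 by blast
    then show ?thesis
      by (rule continuous_on_eq) (auto simp: v_eq)
  qed
  \<comment> \<open>Continuity up to the terminal time reduces the limit to the value at
    \<open>T\<close>, where the integral in the exponent is over a single point and the factor is
    1.\<close>
  have limit: "((\<lambda>t. v t (x, y)) \<longlongrightarrow> gconc (ell x - y)) (at_left T)" for x y
  proof -
    have "continuous_on {0..T} (\<lambda>t. v t (x, y))"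
      by (rule continuous_on_compose_pair[OF v_cont]) (auto intro!: continuous_intros)
    then have "((\<lambda>t. v t (x, y)) \<longlongrightarrow> v T (x, y)) (at T within {0..T})"
      using T_pos unfolding continuous_on_def by auto
    then show ?thesis
      using T_pos v_def[of T x y] by (simp add: at_within_Icc_at_left w_terminal)
  qed
  have pde: "ereal (- time_deriv T v t (x, y) - 1/2 * laplacian (\<lambda>x'. v t (x', y)) x
             - r t * y * deriv (\<lambda>y'. v t (x, y')) y)
        - Ham_F \<mu> f t x (grad (v t) (x, y)) (hess (v t) (x, y)) = 0"
    if t: "t \<in> {0..<T}" for t x y
  proof -
    let ?m = "grad (w t) x"
    define D1 where "D1 = deriv gconc (u t (x, y))"
    define D2 where "D2 = deriv (deriv gconc) (u t (x, y))"
    have tT: "t \<in> {0..T}" using t by simp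
    have grad_u: "grad (u t) (x, y) = (E t *\<^sub>R ?m, - E t)"
      using grad_eqI[OF GDERIV_affine_prod[where p = "(x, y)" and c = "E t", OF dw(1)[OF t]]]
      by (simp add: u_def[abs_def])
    have hess_u: "hess (u t) (x, y) i j = E t * hess (w t) x (fst i) (fst j)" for i j
      using hess_affine_prod[where p = "(x, y)" and c = "E t", OF dw[OF t]] by (simp add: u_def[abs_def])
    have grad_v: "grad (v t) (x, y) = ((D1 * E t) *\<^sub>R ?m, - (D1 * E t))"
      using grad_eqI[OF GDERIV_compose_C2[OF gconc_C2 du(1)[OF t]]]
      by (simp add: v_eq[OF tT] grad_u D1_def)
    have hess_v: "hess (v t) (x, y) i j =
        D2 * (E t)\<^sup>2 * (?m \<bullet> fst i - snd i) * (?m \<bullet> fst j - snd j)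
        + D1 * E t * hess (w t) x (fst i) (fst j)" for i j
      by (simp add: v_eq[OF tT] hess_compose_C2[OF gconc_C2 du[OF t]] grad_u hess_u D1_def D2_def
          inner_prod_def power2_eq_square algebra_simps)
    have "time_deriv T u t (x, y) = time_deriv T w t x * E t + (w t x - y) * (- r t * E t)"
      using time_deriv_affine_prod[where p = "(x, y)", OF w_C12 E_deriv'[OF t] t]
      by (simp add: u_def[abs_def])
    moreover have "time_deriv T v t (x, y) = D1 * time_deriv T u t (x, y)"
      using time_deriv_cong[of T v "\<lambda>t p. gconc (u t p)", OF _ t] v_eq
        time_deriv_compose_C2[where x = "(x, y)", OF gconc_C2 u_C12 t]
      by (simp add: D1_def)
    ultimately have dt: "time_deriv T v t (x, y) =
        D1 * (time_deriv T w t x * E t + (w t x - y) * (- r t * E t))"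
      by simp
    have "(\<lambda>x'. (w t x' - y) * E t) differentiable (at z)" for z
      using GDERIV_affine[OF dw(1)[OF t]] unfolding gderiv_def by (rule differentiableI)
    moreover have "grad (\<lambda>x'. (w t x' - y) * E t) differentiable (at x)"
      using has_derivative_grad_affine[OF dw[OF t]] by (rule differentiableI)
    ultimately have lap: "laplacian (\<lambda>x'. v t (x', y)) x =
        D2 * (E t)\<^sup>2 * (norm ?m)\<^sup>2 + D1 * E t * laplacian (w t) x"
      by (simp add: v_eq[OF tT] u_def laplacian_compose_C2[OF gconc_C2] laplacian_affine[OF dw[OF t]]
          grad_eqI[OF GDERIV_affine[OF dw(1)[OF t]]] power_mult_distrib D1_def D2_def)
    have dy: "deriv (\<lambda>y'. v t (x, y')) y = - (D1 * E t)"
    proof (rule DERIV_imp_deriv)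
      have "((\<lambda>y'. u t (x, y')) has_real_derivative - E t) (at y)"
        unfolding u_def by (auto intro!: derivative_eq_intros)
      from DERIV_chain2[OF G(1) this]
      show "((\<lambda>y'. v t (x, y')) has_real_derivative - (D1 * E t)) (at y)"
        by (simp add: v_eq[OF tT] D1_def)
    qed
    \<comment> \<open>Both blocks have (0, 1) as second argument, so the term with the Hessian of
      \<open>w\<close> vanishes and only the rank-one term is left.\<close>
    have "block_yy (hess (v t) (x, y)) = D2 * (E t)\<^sup>2"
      by (simp add: block_yy_def hess_v hess_zero_right[OF dw(2)[OF t]])
    moreover have "block_xy (hess (v t) (x, y)) = - (D2 * (E t)\<^sup>2) *\<^sub>R ?m"
      by (simp add: block_xy_def hess_v hess_zero_right[OF dw(2)[OF t]] vec_eq_iff inner_axis)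
    \<comment> \<open>Here \<open>Ham_F_eq\<close> is used with \<open>c = D1 * E t\<close>,
      \<open>k = D2 * (E t)\<^sup>2\<close> and \<open>m = grad (w t) x\<close>.\<close>
    ultimately have "Ham_F \<mu> f t x (grad (v t) (x, y)) (hess (v t) (x, y)) =
        ereal (D1 * E t * Ham_bar \<mu> f t x ?m - 1/2 * (D2 * (E t)\<^sup>2) * (norm ?m)\<^sup>2)"
      unfolding grad_v
      using G'_nonneg G''_nonpos E_pos[of t]
      by (intro Ham_F_eq compact_A compact_B mu_cont f_cont tT)
        (auto simp: D1_def D2_def mult_nonpos_nonneg less_imp_le)
    moreover have "- time_deriv T v t (x, y) - 1/2 * laplacian (\<lambda>x'. v t (x', y)) x
             - r t * y * deriv (\<lambda>y'. v t (x, y')) y =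
        D1 * E t * Ham_bar \<mu> f t x ?m - 1/2 * (D2 * (E t)\<^sup>2) * (norm ?m)\<^sup>2"
    proof -
      have H: "Ham_bar \<mu> f t x ?m = - time_deriv T w t x + r t * w t x - 1/2 * laplacian (w t) x"
        using w_pde[OF t, of x] by simp
      \<comment> \<open>The time derivative contributes \<open>D1 * E t * r t * (w t x - y)\<close>;
        its part in \<open>y\<close> cancels against the term with the y-derivative, leaving the
        \<open>r t * w t x\<close> of the equation for \<open>w\<close>.\<close>
      show ?thesis unfolding dt lap dy H by (simp add: algebra_simps)
    qed
    ultimately show ?thesis by simp
  qed
  show ?thesis
    using v_C12 v_cont pde limit by blast
qed

end
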